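(* Let $s$, $r$ and $n$ be positive integers such that $s/2<r<s$, and let $H$ be a graph. If $C_{2s+1}^{\square n}\xrightarrow{2}H$ or $K_s^{\square n}\xrightarrow{r}H$, then $H$ is layered.
   Context: Graphs are finite and simple. $C_m$ is the cycle on $m$ vertices and $K_s$ is the complete graph on $s$ vertices. The Cartesian product $G\square H$ of graphs $G,H$ has vertex set $V(G)\times V(H)$, and $(x_1,x_2),(y_1,y_2)$ are adjacent iff either $x_1y_1\in E(G)$ and $x_2=y_2$, or $x_1=y_1$ and $x_2y_2\in E(H)$. The $n$-th Cartesian power is $G^{\square 1}=G$, $G^{\square n}=G^{\square (n-1)}\square G$ for $n\ge 2$. The hypercube is $Q_n=K_2^{\square n}$ with $V(K_2)=\{0,1\}$. The $i$-th vertex layer of $Q_n$ is the set of vertices with exactly $i$ ones; the $i$-th edge layer of $Q_n$ is the subgraph induced by the $i$-th and $(i+1)$-st vertex layers. A graph is layered if it is (isomorphic to) a subgraph of an edge layer of some hypercube. For positive integers $r,n$, $G^{\square n}\xrightarrow{r}H$ means that every coloring of the vertices of $G^{\square n}$ with $r$ colors contains a monochromatic copy of $H$, i.e. a (not necessarily induced) subgraph isomorphic to $H$ all of whose vertices have the same color. *)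

theory Defs
  imports Complex_Main "HOL-Library.FuncSet" "Graph_Theory.Graph_Theory"
begin

text \<open>
  Finite simple graphs are the structures satisfying \<open>pair_graph\<close>: finitely many
  vertices, no loops, and a symmetric arc relation, so that an edge \<open>uv\<close> is the pair of arcs
  \<open>(u, v)\<close>, \<open>(v, u)\<close>.
\<close>

definition complete_graph :: "nat \<Rightarrow> nat pair_pre_digraph" where
  "complete_graph s = \<lparr> pverts = {..<s}, parcs = {(u, v). u < s \<and> v < s \<and> u \<noteq> v} \<rparr>"

text \<open>This is the cycle on \<open>m\<close> vertices for \<open>m \<ge> 3\<close> only.\<close>

definition cycle_graph :: "nat \<Rightarrow> nat pair_pre_digraph" where
  "cycle_graph m = \<lparr> pverts = {..<m},
     parcs = {(u, v). u < m \<and> v < m \<and> (v = (u + 1) mod m \<or> u = (v + 1) mod m)} \<rparr>"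

definition cart_prod ::
  "'a pair_pre_digraph \<Rightarrow> 'b pair_pre_digraph \<Rightarrow> ('a \<times> 'b) pair_pre_digraph" where
  "cart_prod G H = \<lparr> pverts = pverts G \<times> pverts H,
     parcs = {((x1, x2), (y1, y2)).
       (x1, x2) \<in> pverts G \<times> pverts H \<and> (y1, y2) \<in> pverts G \<times> pverts H \<and>
       ((x1, y1) \<in> parcs G \<and> x2 = y2 \<or> x1 = y1 \<and> (x2, y2) \<in> parcs H)} \<rparr>"

definition relabel :: "('a \<Rightarrow> 'b) \<Rightarrow> 'a pair_pre_digraph \<Rightarrow> 'b pair_pre_digraph" where
  "relabel f G = \<lparr> pverts = f ` pverts G, parcs = map_prod f f ` parcs G \<rparr>"

text \<open>
  The iterated pairs \<open>((x\<^sub>1, x\<^sub>2), \<dots>, x\<^sub>n)\<close> are flattened to lists \<open>[x\<^sub>1, \<dots>, x\<^sub>n]\<close>, so that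
  all powers have the same vertex type. The power \<open>0\<close> (a single vertex) only serves to start
  the recursion; \<open>cart_power_1\<close> below gives the first power.
\<close>

primrec cart_power :: "'a pair_pre_digraph \<Rightarrow> nat \<Rightarrow> 'a list pair_pre_digraph" where
  "cart_power G 0 = \<lparr> pverts = {[]}, parcs = {} \<rparr>"
| "cart_power G (Suc n) = relabel (\<lambda>(xs, x). xs @ [x]) (cart_prod (cart_power G n) G)"

definition hypercube :: "nat \<Rightarrow> nat list pair_pre_digraph" where
  "hypercube n = cart_power (complete_graph 2) n"

definition vertex_layer :: "nat \<Rightarrow> nat \<Rightarrow> nat list set" where
  "vertex_layer n i = {v \<in> pverts (hypercube n). count_list v 1 = i}"

definition edge_layer :: "nat \<Rightarrow> nat \<Rightarrow> (nat list, nat list \<times> nat list) pre_digraph" where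
  "edge_layer n i =
     induce_subgraph (with_proj (hypercube n)) (vertex_layer n i \<union> vertex_layer n (i + 1))"

text \<open>\<open>K\<close> is a (not necessarily induced) subgraph of \<open>G\<close> that is isomorphic to \<open>H\<close>.\<close>

definition is_copy ::
  "'b pair_pre_digraph \<Rightarrow> 'a pair_pre_digraph \<Rightarrow> ('b, 'b \<times> 'b) pre_digraph \<Rightarrow> bool" where
  "is_copy K H G \<longleftrightarrow>
     pair_graph K \<and> subgraph (with_proj K) G \<and> digraph_iso (with_proj H) (with_proj K)"

definition layered :: "'a pair_pre_digraph \<Rightarrow> bool" where
  "layered H \<longleftrightarrow> (\<exists>n i K. n \<ge> 1 \<and> i < n \<and> is_copy K H (edge_layer n i))"

text \<open>\<open>arrows G r H\<close> is the relation \<open>G \<rightarrow> H\<close> for vertex colorings with \<open>r\<close> colors.\<close>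

definition arrows :: "'b pair_pre_digraph \<Rightarrow> nat \<Rightarrow> 'a pair_pre_digraph \<Rightarrow> bool" where
  "arrows G r H \<longleftrightarrow>
     (\<forall>c \<in> pverts G \<rightarrow> {..<r}.
        \<exists>K. is_copy K H (with_proj G) \<and> (\<forall>u \<in> pverts K. \<forall>v \<in> pverts K. c u = c v))"

lemma pair_graphI:
  assumes "finite (pverts G)" "parcs G \<subseteq> pverts G \<times> pverts G" "sym (parcs G)"
    and "\<And>v. (v, v) \<notin> parcs G"
  shows "pair_graph G"
proof
  show "finite (parcs G)"
    using assms(1,2) by (meson finite_SigmaI finite_subset)
  show "symmetric (with_proj G)"
    using assms(3) by (simp add: symmetric_def)
next
  fix e assume "e \<in> parcs G"
  then show "fst e \<in> pverts G" "snd e \<in> pverts G" "fst e \<noteq> snd e"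
    using assms(2,4) by (cases e; auto)+
qed (fact assms)

lemma pair_graph_complete_graph: "pair_graph (complete_graph s)"
  by (rule pair_graphI) (auto simp: complete_graph_def sym_def)

lemma pair_graph_cycle_graph:
  assumes "m \<ge> 3"
  shows "pair_graph (cycle_graph m)"
proof (rule pair_graphI)
  fix v
  show "(v, v) \<notin> parcs (cycle_graph m)"
    using assms by (cases "v + 1 = m") (auto simp: cycle_graph_def)
qed (auto simp: cycle_graph_def sym_def)

lemma pair_graphD:
  assumes "pair_graph G"
  shows "finite (pverts G)" "parcs G \<subseteq> pverts G \<times> pverts G" "sym (parcs G)"
    and "(v, v) \<notin> parcs G"
proof -
  interpret pair_graph G by fact
  show "finite (pverts G)" "parcs G \<subseteq> pverts G \<times> pverts G" "sym (parcs G)" "(v, v) \<notin> parcs G"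
    using arcs_symmetric no_loops' by (auto simp: pair_finite_verts in_arcsD1 in_arcsD2 sym_def)
qed

lemma pair_graph_cart_prod:
  assumes "pair_graph G" "pair_graph H"
  shows "pair_graph (cart_prod G H)"
  using pair_graphD[OF assms(1)] pair_graphD[OF assms(2)]
  by (intro pair_graphI) (auto simp: cart_prod_def sym_def)

lemma pair_graph_relabel:
  assumes "pair_graph G" "inj_on f (pverts G)"
  shows "pair_graph (relabel f G)"
proof -
  note G = pair_graphD[OF assms(1)]
  have "(w, w) \<notin> map_prod f f ` parcs G" for w
    using G(2,4) assms(2) by (fastforce simp: inj_on_def)
  moreover have "sym (map_prod f f ` parcs G)"
    using G(3) by (force simp: sym_def)
  ultimately show ?thesis
    using G by (intro pair_graphI) (auto simp: relabel_def)
qed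

lemma pair_graph_cart_power:
  assumes "pair_graph G"
  shows "pair_graph (cart_power G n)"
proof (induction n)
  case 0
  show ?case by (rule pair_graphI) (auto simp: sym_def)
next
  case (Suc n)
  then show ?case
    using assms by (auto intro!: pair_graph_relabel pair_graph_cart_prod inj_onI)
qed

lemma cart_power_1:
  assumes "pair_graph G"
  shows "cart_power G 1 = relabel (\<lambda>x. [x]) G"
  using pair_graphD[OF assms] by (force simp: relabel_def cart_prod_def image_iff)

end

theory Submission
  imports Defs
begin

text \<open>
  In both cases some vertex coloring of the power \<open>G\<^sup>n\<close> has color classes that span
  layered graphs. Give the vertices of \<open>G\<close> weights in \<open>{0..2r-2}\<close> such that adjacent vertices
  have different weights, let \<open>S(x)\<close> be the sum of the weights of the coordinates of \<open>x\<close>, and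
  color \<open>x\<close> by the residue of \<open>\<lfloor>S(x)/2\<rfloor>\<close> modulo \<open>r\<close>. Along an edge the sum \<open>S\<close> changes by at
  least \<open>1\<close> and at most \<open>2r-2\<close>, so \<open>\<lfloor>S/2\<rfloor>\<close> changes by less than \<open>r\<close>; hence a monochromatic edge
  leaves \<open>\<lfloor>S/2\<rfloor>\<close> unchanged, and \<open>S\<close> moves between the two consecutive values \<open>2\<lfloor>S/2\<rfloor>\<close> and
  \<open>2\<lfloor>S/2\<rfloor> + 1\<close> (\<open>same_block_if_close\<close>). Writing each coordinate in unary (\<open>thermometer\<close>)
  turns \<open>S\<close> into the number of ones and a monochromatic edge into an edge of a hypercube, so a
  monochromatic component lies in one edge layer.

  Two things remain. Different components may lie in different layers, and the unary code forgets
  which of several vertices of equal weight occurs in a coordinate. If the vertices of \<open>G\<close> carry a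
  label that is constant along edges between consecutive weights and separates vertices of equal
  weight, then the list of labels is constant on monochromatic components; recording it in extra
  bits, together with a number of ones that lifts all components to a common layer, embeds the
  whole color class in a single edge layer (\<open>layered_if_piecewise_layered\<close>).

  For \<open>K\<^sub>s\<close> the weights \<open>0, \<dots>, s - 1\<close> serve, because \<open>s - 1 \<le> 2r - 2\<close>. For the odd cycle and
  \<open>r = 2\<close>, the weights around the cycle are \<open>0, 1, 2, 0, 2, 0, 2, \<dots>, 0, 2\<close>: only the two edges at
  the vertex of weight \<open>1\<close> join consecutive weights, so all labels except those of the first three
  vertices can be distinct.
\<close>

section \<open>Cartesian powers and copies\<close>

lemma pverts_cart_power:
  "pverts (cart_power G n) = {xs. length xs = n \<and> set xs \<subseteq> pverts G}"
proof (induction n)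
  case (Suc n)
  show ?case
  proof (intro set_eqI)
    fix xs
    show "xs \<in> pverts (cart_power G (Suc n)) \<longleftrightarrow> xs \<in> {xs. length xs = Suc n \<and> set xs \<subseteq> pverts G}"
      by (cases xs rule: rev_cases)
        (auto simp: Suc relabel_def cart_prod_def image_iff)
  qed
qed auto

lemma parcs_cart_power:
  assumes "pair_graph G"
  shows "(xs, ys) \<in> parcs (cart_power G n) \<longleftrightarrow>
    xs \<in> pverts (cart_power G n) \<and> (\<exists>i<n. \<exists>y. (xs ! i, y) \<in> parcs G \<and> ys = xs[i := y])"
proof (induction n arbitrary: xs ys)
  case (Suc n)
  show ?case
  proof (cases "length xs = Suc n \<and> length ys = Suc n")
    case False
    then show ?thesis
      using pair_graphD(2)[OF pair_graph_cart_power[OF assms, of "Suc n"]]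
      by (auto simp: pverts_cart_power simp del: cart_power.simps)
  next
    case True
    then obtain us x vs y where xs: "xs = us @ [x]" and ys: "ys = vs @ [y]"
      and len: "length us = n" "length vs = n"
      by (metis length_Suc_conv_rev)
    have "(xs, ys) \<in> parcs (cart_power G (Suc n)) \<longleftrightarrow>
        ((us, x), (vs, y)) \<in> parcs (cart_prod (cart_power G n) G)"
      by (auto simp: xs ys relabel_def image_iff Bex_def)
    also have "\<dots> \<longleftrightarrow> us \<in> pverts (cart_power G n) \<and> x \<in> pverts G \<and>
        ((us, vs) \<in> parcs (cart_power G n) \<and> x = y \<or> us = vs \<and> (x, y) \<in> parcs G)"
      using pair_graphD(2)[OF pair_graph_cart_power[OF assms, of n]] pair_graphD(2)[OF assms]
      by (auto simp: cart_prod_def)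
    also have "\<dots> \<longleftrightarrow> set xs \<subseteq> pverts G \<and>
        ((\<exists>i<n. \<exists>z. (us ! i, z) \<in> parcs G \<and> vs = us[i := z] \<and> x = y) \<or>
         us = vs \<and> (x, y) \<in> parcs G)"
      using len by (auto simp: Suc.IH pverts_cart_power xs)
    also have "\<dots> \<longleftrightarrow> xs \<in> pverts (cart_power G (Suc n)) \<and>
        (\<exists>i<Suc n. \<exists>z. (xs ! i, z) \<in> parcs G \<and> ys = xs[i := z])"
      unfolding pverts_cart_power using len
      by (auto simp: less_Suc_eq xs ys nth_append list_update_append)
    finally show ?thesis .
  qed
qed auto

text \<open>
  An isomorphism of digraphs carries a separate map on arcs. Here the arcs are pairs of vertices,
  so the vertex map determines it, and a copy amounts to an injective homomorphism.
\<close>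

lemma is_copyE:
  assumes "is_copy K H (with_proj G)"
  obtains f where "inj_on f (pverts H)" "f ` pverts H = pverts K"
    "pverts K \<subseteq> pverts G" "\<And>u v. (u, v) \<in> parcs H \<Longrightarrow> (f u, f v) \<in> parcs G"
proof -
  obtain h where h: "pre_digraph.digraph_isomorphism (with_proj H) h"
    and K: "with_proj K = app_iso h (with_proj H)"
    using assms by (auto simp: is_copy_def digraph_iso_def)
  have sub: "pverts K \<subseteq> pverts G" "parcs K \<subseteq> parcs G"
    using assms by (auto simp: is_copy_def subgraph_def)
  have verts: "iso_verts h ` pverts H = pverts K" and arcs: "iso_arcs h ` parcs H = parcs K"
    and tail: "iso_tail h = fst" and head: "iso_head h = snd"
    using arg_cong[OF K, of verts] arg_cong[OF K, of arcs]
      arg_cong[OF K, of tail] arg_cong[OF K, of head] by simp_all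
  have "(iso_verts h u, iso_verts h v) \<in> parcs G" if "(u, v) \<in> parcs H" for u v
  proof -
    have "iso_arcs h (u, v) = (iso_verts h u, iso_verts h v)"
      using h that by (auto simp: pre_digraph.digraph_isomorphism_def tail head prod_eq_iff)
    then show ?thesis
      using that arcs sub(2) by (metis image_eqI subsetD)
  qed
  with verts sub(1) h show thesis
    by (intro that[of "iso_verts h"]) (auto simp: pre_digraph.digraph_isomorphism_def)
qed

lemma is_copy_relabel:
  assumes H: "pair_graph H" and inj: "inj_on f (pverts H)"
    and sub: "subgraph (with_proj (relabel f H)) G"
  shows "is_copy (relabel f H) H G"
proof -
  interpret H: pair_graph H by fact
  let ?h = "\<lparr> iso_verts = f, iso_arcs = map_prod f f, iso_head = snd, iso_tail = fst \<rparr>"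
  have "inj_on (map_prod f f) (parcs H)"
    using map_prod_inj_on[OF inj inj] pair_graphD(2)[OF H] by (rule inj_on_subset)
  then have "pre_digraph.digraph_isomorphism (with_proj H) ?h"
    using inj by (auto simp: pre_digraph.digraph_isomorphism_def H.wf_digraph_axioms)
  moreover have "with_proj (relabel f H) = app_iso ?h (with_proj H)"
    by (simp add: with_proj_def relabel_def app_iso_def)
  ultimately show ?thesis
    using pair_graph_relabel[OF H inj] sub by (auto simp: is_copy_def digraph_iso_def)
qed

section \<open>Layeredness in terms of set systems\<close>

text \<open>
  Below, a vertex of a hypercube is a subset of a finite ground set: adjacency becomes a one-element
  symmetric difference, the number of ones becomes the cardinality, and appending bits becomes a
  disjoint sum of ground sets. An enumeration \<open>es\<close> of the ground set translates back to bit lists.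
\<close>

definition indicator_list :: "'x list \<Rightarrow> 'x set \<Rightarrow> nat list" where
  "indicator_list es A = map (\<lambda>e. if e \<in> A then 1 else 0) es"

lemma indicator_list_in_hypercube:
  "indicator_list es A \<in> pverts (hypercube (length es))"
  by (auto simp: hypercube_def pverts_cart_power indicator_list_def complete_graph_def)

lemma count_indicator_list:
  assumes "distinct es"
  shows "count_list (indicator_list es A) 1 = card (A \<inter> set es)"
  using assms by (induction es) (auto simp: indicator_list_def card_insert_if Int_insert_right)

lemma inj_on_indicator_list: "inj_on (indicator_list es) (Pow (set es))"
  by (rule inj_onI) (auto simp: indicator_list_def split: if_splits)

lemma indicator_list_adjacent:
  assumes "distinct es" "A \<subseteq> set es" "B \<subseteq> set es" "sym_diff A B = {e}"
  shows "(indicator_list es A, indicator_list es B) \<in> parcs (hypercube (length es))"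
proof -
  have AB: "x \<in> A \<longleftrightarrow> (x \<in> B \<longleftrightarrow> x \<noteq> e)" for x
    using assms(4) by auto
  have "e \<in> set es" using assms by blast
  then obtain i where i: "i < length es" "es ! i = e"
    by (auto simp: in_set_conv_nth)
  let ?b = "if e \<in> B then 1 else 0 :: nat"
  have "indicator_list es B = (indicator_list es A)[i := ?b]"
    using i assms(1)
    by (intro nth_equalityI) (auto simp: indicator_list_def nth_list_update AB nth_eq_iff_index_eq)
  moreover have "(indicator_list es A ! i, ?b) \<in> parcs (complete_graph 2)"
    using i AB[of e] by (auto simp: indicator_list_def complete_graph_def)
  ultimately show ?thesis
    using i(1) indicator_list_in_hypercube[of es A]
    unfolding hypercube_def parcs_cart_power[OF pair_graph_complete_graph] by blast
qed

lemma layered_if_set_embedding: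
  fixes \<Phi> :: "'a \<Rightarrow> 'x set"
  assumes H: "pair_graph H" and X: "finite X" "i < card X"
    and inj: "inj_on \<Phi> (pverts H)"
    and \<Phi>: "\<And>v. v \<in> pverts H \<Longrightarrow> \<Phi> v \<subseteq> X" "\<And>v. v \<in> pverts H \<Longrightarrow> card (\<Phi> v) \<in> {i, i + 1}"
    and adj: "\<And>u v. (u, v) \<in> parcs H \<Longrightarrow> \<exists>e. sym_diff (\<Phi> u) (\<Phi> v) = {e}"
  shows "layered H"
proof -
  obtain es where es: "distinct es" "set es = X"
    using X(1) finite_distinct_list by blast
  define n where "n = length es"
  have n: "n = card X" using es by (simp add: n_def distinct_card[symmetric])
  let ?f = "\<lambda>v. indicator_list es (\<Phi> v)"
  let ?V = "vertex_layer n i \<union> vertex_layer n (i + 1)"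
  have inj_f: "inj_on ?f (pverts H)"
    using comp_inj_on[OF inj, of "indicator_list es"] inj_on_indicator_list[of es] \<Phi>(1) es(2)
    by (auto simp: comp_def intro: inj_on_subset)
  have V: "?f v \<in> ?V" if "v \<in> pverts H" for v
  proof -
    have "count_list (?f v) 1 = card (\<Phi> v)"
      using \<Phi>(1)[OF that] es by (simp only: count_indicator_list Int_absorb2)
    then show ?thesis
      using \<Phi>(2)[OF that] indicator_list_in_hypercube[of es "\<Phi> v"]
      by (auto simp: vertex_layer_def n_def)
  qed
  have E: "(?f u, ?f v) \<in> parcs (hypercube n)" if "(u, v) \<in> parcs H" for u v
    using that adj[OF that] \<Phi>(1) es pair_graphD(2)[OF H]
    by (auto simp: n_def intro!: indicator_list_adjacent)
  have Q: "pair_graph (hypercube n)"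
    unfolding hypercube_def by (intro pair_graph_cart_power pair_graph_complete_graph)
  then interpret Q: pair_graph "hypercube n" .
  have R: "pair_graph (relabel ?f H)" by (rule pair_graph_relabel[OF H inj_f])
  then interpret R: pair_graph "relabel ?f H" .
  have "subgraph (with_proj (relabel ?f H)) (edge_layer n i)"
    unfolding subgraph_def
  proof (intro conjI)
    show "wf_digraph (edge_layer n i)"
      unfolding edge_layer_def by (rule Q.wellformed_induce_subgraph)
    show "wf_digraph (with_proj (relabel ?f H))" by (rule R.wf_digraph_axioms)
    show "verts (with_proj (relabel ?f H)) \<subseteq> verts (edge_layer n i)"
      using V by (auto simp: edge_layer_def relabel_def)
    show "arcs (with_proj (relabel ?f H)) \<subseteq> arcs (edge_layer n i)"
    proof
      fix a assume "a \<in> arcs (with_proj (relabel ?f H))"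
      then obtain u v where uv: "(u, v) \<in> parcs H" "a = (?f u, ?f v)"
        by (auto simp: relabel_def)
      then have "?f u \<in> ?V" "?f v \<in> ?V" using V pair_graphD(2)[OF H] by auto
      then show "a \<in> arcs (edge_layer n i)"
        using E[OF uv(1)] uv(2) by (simp add: edge_layer_def)
    qed
    show "compatible (edge_layer n i) (with_proj (relabel ?f H))"
      by (simp add: compatible_def edge_layer_def)
  qed
  then have "is_copy (relabel ?f H) H (edge_layer n i)"
    by (rule is_copy_relabel[OF H inj_f])
  then show ?thesis
    using X(2) n unfolding layered_def by (intro exI[of _ n] exI[of _ i]) auto
qed

lemma sym_diff_Plus_same:
  "sym_diff (A <+> C) (B <+> C) = Inl ` sym_diff A B"
  by auto

text \<open>
  The pieces are the level sets of \<open>(\<kappa>, l)\<close>: no edge leaves a piece, and each piece is mapped into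
  the layers \<open>l\<close> and \<open>l + 1\<close>, possibly overlapping the images of other pieces. One extra bit for
  each value of \<open>\<kappa>\<close> separates the images, and padding by \<open>N - l\<close> ones moves all of them to the same
  edge layer. Neither changes along an edge, so edges of \<open>H\<close> remain edges of a hypercube.
\<close>

lemma layered_if_piecewise_layered:
  fixes \<phi> :: "'a \<Rightarrow> 'x set" and \<kappa> :: "'a \<Rightarrow> 'k" and l :: "'a \<Rightarrow> nat"
  assumes H: "pair_graph H" and X: "finite X"
    and \<phi>: "\<And>v. v \<in> pverts H \<Longrightarrow> \<phi> v \<subseteq> X" "\<And>v. v \<in> pverts H \<Longrightarrow> card (\<phi> v) \<in> {l v, l v + 1}"
    and inj: "inj_on (\<lambda>v. (\<phi> v, \<kappa> v)) (pverts H)"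
    and adj: "\<And>u v. (u, v) \<in> parcs H \<Longrightarrow> \<exists>e. sym_diff (\<phi> u) (\<phi> v) = {e}"
    and const: "\<And>u v. (u, v) \<in> parcs H \<Longrightarrow> \<kappa> u = \<kappa> v \<and> l u = l v"
  shows "layered H"
proof -
  define N where "N = card X"
  define \<Phi> where "\<Phi> v = \<phi> v <+> ({\<kappa> v} <+> {..<N - l v})" for v
  \<comment> \<open>Padding never uses more than \<open>N\<close> bits; two more make sure that \<open>N + 1\<close> is the index of an
    edge layer even if \<open>H\<close> has no vertices.\<close>
  let ?Y = "X <+> (\<kappa> ` pverts H <+> {..<N + 2})"
  note fin = pair_graphD(1)[OF H]
  show ?thesis
  proof (rule layered_if_set_embedding[OF H])
    show "finite ?Y" using X fin by auto
    show "N + 1 < card ?Y" using X fin by (simp add: card_Plus)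
    have "\<phi> v = Inl -` \<Phi> v" "{\<kappa> v} = Inl -` (Inr -` \<Phi> v)" for v
      by (auto simp: \<Phi>_def)
    then have "(\<phi> u, \<kappa> u) = (\<phi> v, \<kappa> v)" if "\<Phi> u = \<Phi> v" for u v
      using that by (metis singleton_inject)
    then show "inj_on \<Phi> (pverts H)"
      using inj unfolding inj_on_def by blast
  next
    fix v assume v: "v \<in> pverts H"
    show "\<Phi> v \<subseteq> ?Y" using \<phi>(1)[OF v] v by (auto simp: \<Phi>_def)
    have "finite (\<phi> v)" "card (\<phi> v) \<le> N"
      using \<phi>(1)[OF v] X by (auto simp: N_def finite_subset card_mono)
    then show "card (\<Phi> v) \<in> {N + 1, N + 1 + 1}"
      using \<phi>(2)[OF v] by (auto simp: \<Phi>_def card_Plus)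
  next
    fix u v assume uv: "(u, v) \<in> parcs H"
    obtain e where "sym_diff (\<phi> u) (\<phi> v) = {e}" using adj[OF uv] by blast
    then have "sym_diff (\<Phi> u) (\<Phi> v) = {Inl e}"
      unfolding \<Phi>_def using const[OF uv] by (simp only: sym_diff_Plus_same image_insert image_empty)
    then show "\<exists>e. sym_diff (\<Phi> u) (\<Phi> v) = {e}" by blast
  qed
qed

section \<open>Colorings by weight sums\<close>

text \<open>
  As a bit string, this concatenates the unary codes \<open>1\<dots>10\<dots>0\<close> of the weights of the coordinates.
  Consecutive weights have codes that differ in one bit.
\<close>

definition thermometer :: "('b \<Rightarrow> nat) \<Rightarrow> 'b list \<Rightarrow> (nat \<times> nat) set" where
  "thermometer w xs = (SIGMA i:{..<length xs}. {..<w (xs ! i)})"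

lemma card_thermometer: "card (thermometer w xs) = sum_list (map w xs)"
  by (simp add: thermometer_def sum_list_sum_nth atLeast0LessThan)

lemma thermometer_step:
  assumes "i < length xs" "w y = w (xs ! i) + 1 \<or> w (xs ! i) = w y + 1"
  shows "\<exists>e. sym_diff (thermometer w xs) (thermometer w (xs[i := y])) = {e}"
proof -
  have "sym_diff (thermometer w xs) (thermometer w (xs[i := y])) = {(i, min (w y) (w (xs ! i)))}"
    using assms by (auto simp: thermometer_def nth_list_update split: if_splits)
  then show ?thesis by blast
qed

lemma map_eq_if_thermometer_eq:
  assumes "thermometer w xs = thermometer w ys" "length xs = length ys"
  shows "map w xs = map w ys"
proof (rule nth_equalityI)
  fix i assume i: "i < length (map w xs)"
  have "{..<w (xs ! i)} = thermometer w xs `` {i}" "{..<w (ys ! i)} = thermometer w ys `` {i}"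
    using i assms(2) by (auto simp: thermometer_def)
  with assms(1) have "{..<w (xs ! i)} = {..<w (ys ! i)}" by simp
  then show "map w xs ! i = map w ys ! i" using i assms(2) by (simp add: lessThan_eq_iff)
qed (simp add: assms(2))

text \<open>
  The arithmetic behind the coloring: integers at distance at most \<open>2r - 2\<close> have halves at distance
  less than \<open>r\<close>, so halves that agree modulo \<open>r\<close> are equal. The bound is sharp, since \<open>1\<close> and
  \<open>2r\<close> are at distance \<open>2r - 1\<close> and their halves \<open>0\<close> and \<open>r\<close> agree modulo \<open>r\<close>.
\<close>

lemma same_block_if_close:
  fixes a b r :: nat
  assumes "a < b" "b \<le> a + (2 * r - 2)" "a div 2 mod r = b div 2 mod r"
  shows "b = a + 1" "a div 2 = b div 2"
proof -
  have "b div 2 - a div 2 < r" using assms(1,2) by linarith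
  moreover have "r dvd b div 2 - a div 2"
    using assms(1,3) by (metis div_le_mono less_imp_le mod_eq_dvd_iff_nat)
  ultimately show "a div 2 = b div 2"
    using assms(1) by (metis diff_is_0_eq div_le_mono dvd_imp_le le_antisym less_imp_le
        linorder_not_less neq0_conv)
  then show "b = a + 1" using assms(1) by linarith
qed

text \<open>
  This isolates what the coloring needs from \<open>G\<close>. The label \<open>k\<close> records the part of a coordinate
  that the weight forgets; since a monochromatic edge changes one coordinate along an edge of \<open>G\<close>
  between consecutive weights, the labels of all coordinates stay constant along it.
\<close>

lemma layered_if_arrows_weighted:
  fixes G :: "'b pair_pre_digraph" and w :: "'b \<Rightarrow> nat" and k :: "'b \<Rightarrow> 'k"
  assumes G: "pair_graph G" and H: "pair_graph H" and r: "r > 0"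
    and w_le: "\<And>x. x \<in> pverts G \<Longrightarrow> w x \<le> 2 * r - 2"
    and proper: "\<And>x y. (x, y) \<in> parcs G \<Longrightarrow> w x \<noteq> w y"
    and k: "\<And>x y. (x, y) \<in> parcs G \<Longrightarrow> w y = w x + 1 \<Longrightarrow> k x = k y"
    and inj: "inj_on (\<lambda>x. (w x, k x)) (pverts G)"
    and arrows: "arrows (cart_power G n) r H"
  shows "layered H"
proof -
  let ?S = "\<lambda>xs. sum_list (map w xs)"
  define c where "c xs = ?S xs div 2 mod r" for xs
  have "c \<in> pverts (cart_power G n) \<rightarrow> {..<r}" using r by (auto simp: c_def)
  then obtain K where K: "is_copy K H (with_proj (cart_power G n))"
    and mono: "\<And>u v. u \<in> pverts K \<Longrightarrow> v \<in> pverts K \<Longrightarrow> c u = c v"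
    using arrows unfolding arrows_def by blast
  obtain f where f: "inj_on f (pverts H)" "f ` pverts H = pverts K"
    "pverts K \<subseteq> pverts (cart_power G n)"
    "\<And>u v. (u, v) \<in> parcs H \<Longrightarrow> (f u, f v) \<in> parcs (cart_power G n)"
    using is_copyE[OF K] by metis
  have f_in: "length (f v) = n" "set (f v) \<subseteq> pverts G" if "v \<in> pverts H" for v
    using that f(2,3) by (auto simp: pverts_cart_power)
  have edge: "(\<exists>e. sym_diff (thermometer w (f u)) (thermometer w (f v)) = {e}) \<and>
      map k (f u) = map k (f v) \<and> ?S (f u) div 2 = ?S (f v) div 2"
    if uv: "(u, v) \<in> parcs H" for u v
  proof -
    have in_H: "u \<in> pverts H" "v \<in> pverts H" using uv pair_graphD(2)[OF H] by auto
    obtain i y where i: "i < n" and y: "(f u ! i, y) \<in> parcs G" and fv: "f v = (f u)[i := y]"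
      using f(4)[OF uv] parcs_cart_power[OF G] by metis
    let ?x = "f u ! i"
    have yx: "(y, ?x) \<in> parcs G" using y pair_graphD(3)[OF G] by (auto dest: symD)
    have w_xy: "w ?x \<le> 2 * r - 2" "w y \<le> 2 * r - 2" "w ?x \<noteq> w y"
      using y w_le proper pair_graphD(2)[OF G] by auto
    have i': "i < length (f u)" using i f_in in_H by simp
    have le: "w ?x \<le> ?S (f u)"
      using i' by (intro member_le_sum_list) auto
    have S: "?S (f v) + w ?x = ?S (f u) + w y"
      using i' le by (simp add: fv map_update sum_list_update)
    have mono_uv: "?S (f u) div 2 mod r = ?S (f v) div 2 mod r"
      using mono in_H f(2) by (auto simp: c_def)
    have "(w y = w ?x + 1 \<or> w ?x = w y + 1) \<and> ?S (f u) div 2 = ?S (f v) div 2"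
    proof (cases "w ?x < w y")
      case True
      then show ?thesis
        using same_block_if_close[of "?S (f u)" "?S (f v)" r] S w_xy mono_uv by linarith
    next
      case False
      then show ?thesis
        using same_block_if_close[of "?S (f v)" "?S (f u)" r] S w_xy mono_uv by linarith
    qed
    moreover from this have "k ?x = k y" using k[OF y] k[OF yx] by auto
    then have "map k (f u) = map k (f v)"
      using i' list_update_id[of "map k (f u)" i] by (simp add: fv map_update)
    ultimately show ?thesis
      using thermometer_step[OF i'] by (simp add: fv)
  qed
  \<comment> \<open>The lower of the two layers used by the component of \<open>x\<close> is the even number among \<open>S(x)\<close> and
    \<open>S(x) - 1\<close>.\<close>
  show ?thesis
  proof (rule layered_if_piecewise_layered[OF H, where \<phi> = "\<lambda>v. thermometer w (f v)"
        and \<kappa> = "\<lambda>v. map k (f v)" and l = "\<lambda>v. 2 * (?S (f v) div 2)"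
        and X = "{..<n} \<times> {..<2 * r - 2}"])
    fix v assume v: "v \<in> pverts H"
    have "w (f v ! i) \<le> 2 * r - 2" if "i < n" for i
      using f_in[OF v] that by (intro w_le) auto
    then show "thermometer w (f v) \<subseteq> {..<n} \<times> {..<2 * r - 2}"
      using f_in[OF v] by (fastforce simp: thermometer_def)
    show "card (thermometer w (f v)) \<in> {2 * (?S (f v) div 2), 2 * (?S (f v) div 2) + 1}"
      using mult_div_mod_eq[of 2 "?S (f v)"] by (auto simp: card_thermometer mod2_eq_if)
  next
    show "inj_on (\<lambda>v. (thermometer w (f v), map k (f v))) (pverts H)"
    proof (rule inj_onI, clarify)
      fix u v assume uv: "u \<in> pverts H" "v \<in> pverts H"
        and eq: "thermometer w (f u) = thermometer w (f v)" "map k (f u) = map k (f v)"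
      have "map w (f u) = map w (f v)"
        using eq(1) f_in uv by (intro map_eq_if_thermometer_eq) auto
      with eq(2) have "map (\<lambda>x. (w x, k x)) (f u) = map (\<lambda>x. (w x, k x)) (f v)"
        by (auto simp: list_eq_iff_nth_eq dest: map_eq_imp_length_eq)
      moreover have "inj_on (\<lambda>x. (w x, k x)) (set (f u) \<union> set (f v))"
        using inj f_in(2)[OF uv(1)] f_in(2)[OF uv(2)] by (auto intro: inj_on_subset)
      ultimately have "f u = f v" by (rule map_inj_on)
      then show "u = v" using f(1) uv by (auto dest: inj_onD)
    qed
  qed (use edge in auto)
qed

section \<open>Weights on complete graphs and odd cycles\<close>

lemma layered_if_arrows_complete:
  assumes "pair_graph H" "s < 2 * r" "arrows (cart_power (complete_graph s) n) r H"
  shows "layered H"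
proof (rule layered_if_arrows_weighted[where w = id and k = "\<lambda>_. ()"])
  show "pair_graph (complete_graph s)" by (rule pair_graph_complete_graph)
  show "arrows (cart_power (complete_graph s) n) r H" by fact
qed (use assms(1,2) in \<open>auto simp: complete_graph_def inj_on_def\<close>)

text \<open>
  Going around the cycle, the weights \<open>0, 1, 2\<close> are followed by \<open>0, 2\<close> repeatedly. A closed walk of
  odd length cannot alternate between \<open>0\<close> and \<open>2\<close>; the single \<open>1\<close> absorbs the parity defect.
\<close>

definition cycle_weight :: "nat \<Rightarrow> nat" where
  "cycle_weight v = (if v = 1 then 1 else if v \<noteq> 0 \<and> even v then 2 else 0)"

lemma cycle_weight_edge:
  assumes "s > 0" "(u, v) \<in> parcs (cycle_graph (2 * s + 1))"
  shows "cycle_weight u \<noteq> cycle_weight v"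
    and "cycle_weight v = cycle_weight u + 1 \<Longrightarrow> u \<le> 2 \<and> v \<le> 2"
proof -
  \<comment> \<open>By symmetry it suffices to treat the arcs that go forward around the cycle.\<close>
  have *: "cycle_weight a \<noteq> cycle_weight b \<and>
      (cycle_weight b = cycle_weight a + 1 \<or> cycle_weight a = cycle_weight b + 1 \<longrightarrow> a \<le> 2 \<and> b \<le> 2)"
    if "a < 2 * s + 1" "b = (a + 1) mod (2 * s + 1)" for a b
  proof (cases "a = 2 * s")
    case True
    \<comment> \<open>The arc from \<open>2 * s\<close> back to \<open>0\<close> goes from weight \<open>2\<close> to weight \<open>0\<close>.\<close>
    then show ?thesis using that assms(1) by (auto simp: cycle_weight_def)
  next
    case False
    then have "b = a + 1" using that by simp
    then show ?thesis by (auto simp: cycle_weight_def)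
  qed
  show "cycle_weight u \<noteq> cycle_weight v"
    and "cycle_weight v = cycle_weight u + 1 \<Longrightarrow> u \<le> 2 \<and> v \<le> 2"
    using assms(2) *[of u v] *[of v u] by (auto simp: cycle_graph_def)
qed

lemma layered_if_arrows_odd_cycle:
  assumes "pair_graph H" "s > 0" "arrows (cart_power (cycle_graph (2 * s + 1)) n) 2 H"
  shows "layered H"
proof (rule layered_if_arrows_weighted[where w = cycle_weight and k = "\<lambda>v. if v \<le> 2 then 0 else v"])
  show "pair_graph (cycle_graph (2 * s + 1))" using assms(2) by (intro pair_graph_cycle_graph) simp
  show "inj_on (\<lambda>v. (cycle_weight v, if v \<le> 2 then 0 else v)) (pverts (cycle_graph (2 * s + 1)))"
  proof (rule inj_onI)
    fix u v
    assume "(cycle_weight u, if u \<le> 2 then 0 else u) = (cycle_weight v, if v \<le> 2 then 0 else v)"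
    moreover have "x \<le> 2 \<longleftrightarrow> x = 0 \<or> x = 1 \<or> x = 2" for x :: nat by auto
    ultimately show "u = v"
      by (cases "u \<le> 2"; cases "v \<le> 2") (auto simp: cycle_weight_def)
  qed
  show "arrows (cart_power (cycle_graph (2 * s + 1)) n) 2 H" by fact
  fix x y assume xy: "(x, y) \<in> parcs (cycle_graph (2 * s + 1))"
  show "cycle_weight x \<noteq> cycle_weight y" by (rule cycle_weight_edge(1)[OF assms(2) xy])
  show "(if x \<le> 2 then 0 else x) = (if y \<le> 2 then 0 else y)" if "cycle_weight y = cycle_weight x + 1"
    using cycle_weight_edge(2)[OF assms(2) xy that] by simp
qed (auto simp: assms(1) cycle_weight_def)

theorem proposition1:
  fixes s r n :: nat and H :: "'a pair_pre_digraph"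
  assumes "s > 0" and "r > 0" and "n > 0"
    and "real s / 2 < real r" and "r < s"
    and "pair_graph H"
    and "arrows (cart_power (cycle_graph (2 * s + 1)) n) 2 H \<or>
         arrows (cart_power (complete_graph s) n) r H"
  shows "layered H"
proof -
  have "s < 2 * r" using assms(4) by linarith
  then show ?thesis
    using assms(1,6,7) layered_if_arrows_odd_cycle layered_if_arrows_complete by blast
qed

end
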